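(* Let $V$ be a vector space over $\mathbb{K}$, let $f:V\to V$ be a linear endomorphism, and let $\sqcup\!\sqcup$, $\prec$, $\bullet$ and $\Delta$ be the shuffle product, the half-shuffle, the product associated to $f$, and the deconcatenation coproduct on $T(V)$. Then: 1. For all $a,b,c\in T(V)$, $(a\sqcup\!\sqcup b)\bullet c=(a\bullet c)\sqcup\!\sqcup b+a\sqcup\!\sqcup(b\bullet c)$. 2. For all words $a,b,c\in T(V)$ such that $(a,b)\neq(\emptyset,\emptyset)$, $(a\prec b)\bullet c=(a\bullet c)\prec b+a\prec(b\bullet c)$. 3. For all $a,b,c\in T(V)$, $(a\bullet b)\bullet c-a\bullet(b\bullet c)=(a\bullet c)\bullet b-a\bullet(c\bullet b)$. 4. For all $a,b\in T(V)$, with Sweedler's notation, $\Delta(a\bullet b)=a^{(1)}\otimes(a^{(2)}\bullet b)+(a^{(1)}\bullet b^{(1)})\otimes(a^{(2)}\sqcup\!\sqcup b^{(2)})$. In particular, by points 1 and 3, $(T(V),\sqcup\!\sqcup,\bullet)$ is a Com-Pre-Lie algebra.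
   Context: $\mathbb{K}$ is a field of characteristic zero. For a vector space $V$, $T(V)=\bigoplus_{n\ge 0}V^{\otimes n}$ is spanned by words $x_1\ldots x_n$ ($=x_1\otimes\cdots\otimes x_n$) with letters in $V$; $\emptyset$ is the empty word; juxtaposition denotes concatenation. The shuffle product $\sqcup\!\sqcup$ is the bilinear product on $T(V)$ with $\emptyset\sqcup\!\sqcup w=w\sqcup\!\sqcup\emptyset=w$ and $xu\sqcup\!\sqcup yv=x(u\sqcup\!\sqcup yv)+y(xu\sqcup\!\sqcup v)$ for $x,y\in V$, $u,v\in T(V)$; it is commutative and associative. The half-shuffle $\prec$ is bilinear with $xu\prec v=x(u\sqcup\!\sqcup v)$ for $x\in V$, $u,v\in T(V)$ (so $w\prec\emptyset=w$ for $w$ a nonempty word), and $\emptyset\prec w=0$ for $w$ a nonempty word; $\emptyset\prec\emptyset$ is not defined. The deconcatenation coproduct is $\Delta(x_1\ldots x_n)=\sum_{i=0}^n x_1\ldots x_i\otimes x_{i+1}\ldots x_n$, and $\Delta(a)=a^{(1)}\otimes a^{(2)}$ is Sweedler's notation. The bilinear product $\bullet$ on $T(V)$ associated to $f$ is defined by induction on the length of words: $\emptyset\bullet w'=0$ and $(xw)\bullet w'=x(w\bullet w')+f(x)(w\sqcup\!\sqcup w')$ for $x\in V$, $w,w'\in T(V)$. A Com-Pre-Lie algebra is a vector space with a commutative associative product $\sqcup\!\sqcup$ and a bilinear product $\bullet$ satisfying the identities of points 1 and 3 for all $a,b,c$. *)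

theory Defs
  imports Complex_Main "HOL-Algebra.Module" "HOL-Library.Poly_Mapping"
begin

section \<open>Free vector spaces and their quotients\<close>

text \<open>The free vector space over a field \<open>'k\<close> on a type \<open>'x\<close> is the type \<open>'x \<Rightarrow>\<^sub>0 'k\<close> of
  finitely supported functions.\<close>

definition fscale :: "'k::field \<Rightarrow> ('x \<Rightarrow>\<^sub>0 'k) \<Rightarrow> ('x \<Rightarrow>\<^sub>0 'k)" where
  "fscale c p = Poly_Mapping.map ((*) c) p"

lemma lookup_fscale [simp]: "Poly_Mapping.lookup (fscale c p) x = c * Poly_Mapping.lookup p x"
  by (simp add: fscale_def Poly_Mapping.map.rep_eq when_def)

global_interpretation free_space: vector_space "fscale :: 'k::field \<Rightarrow> ('x \<Rightarrow>\<^sub>0 'k) \<Rightarrow> _"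
  by unfold_locales (auto intro!: poly_mapping_eqI simp: lookup_add algebra_simps)

abbreviation gen :: "'x \<Rightarrow> ('x \<Rightarrow>\<^sub>0 'k::field)" where
  "gen x \<equiv> Poly_Mapping.single x 1"

definition lin_ext :: "('x \<Rightarrow> ('y \<Rightarrow>\<^sub>0 'k::field)) \<Rightarrow> ('x \<Rightarrow>\<^sub>0 'k) \<Rightarrow> ('y \<Rightarrow>\<^sub>0 'k)" where
  "lin_ext g p = (\<Sum>x\<in>Poly_Mapping.keys p. fscale (Poly_Mapping.lookup p x) (g x))"

definition bilin_ext ::
    "('x \<Rightarrow> 'y \<Rightarrow> ('z \<Rightarrow>\<^sub>0 'k::field)) \<Rightarrow> ('x \<Rightarrow>\<^sub>0 'k) \<Rightarrow> ('y \<Rightarrow>\<^sub>0 'k) \<Rightarrow> ('z \<Rightarrow>\<^sub>0 'k)" where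
  "bilin_ext g p q = lin_ext (\<lambda>x. lin_ext (g x) q) p"

definition coset :: "('x \<Rightarrow>\<^sub>0 'k::field) set \<Rightarrow> ('x \<Rightarrow>\<^sub>0 'k) \<Rightarrow> ('x \<Rightarrow>\<^sub>0 'k) set" where
  "coset N p = {q. q - p \<in> N}"

text \<open>Maps induced on cosets, in the style of \<open>Equiv_Relations\<close>: when \<open>g\<close> is compatible
  with the subspaces, all members of the union are the same coset. The parameter \<open>N\<close> is the
  subspace divided out of the target.\<close>

definition on_cosets ::
    "('y \<Rightarrow>\<^sub>0 'k::field) set \<Rightarrow> (('x \<Rightarrow>\<^sub>0 'k) \<Rightarrow> ('y \<Rightarrow>\<^sub>0 'k)) \<Rightarrow>
     ('x \<Rightarrow>\<^sub>0 'k) set \<Rightarrow> ('y \<Rightarrow>\<^sub>0 'k) set" where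
  "on_cosets N g P = (\<Union>p\<in>P. coset N (g p))"

definition on_cosets2 ::
    "('z \<Rightarrow>\<^sub>0 'k::field) set \<Rightarrow> (('x \<Rightarrow>\<^sub>0 'k) \<Rightarrow> ('y \<Rightarrow>\<^sub>0 'k) \<Rightarrow> ('z \<Rightarrow>\<^sub>0 'k)) \<Rightarrow>
     ('x \<Rightarrow>\<^sub>0 'k) set \<Rightarrow> ('y \<Rightarrow>\<^sub>0 'k) set \<Rightarrow> ('z \<Rightarrow>\<^sub>0 'k) set" where
  "on_cosets2 N g P Q = (\<Union>p\<in>P. \<Union>q\<in>Q. coset N (g p q))"

text \<open>The quotient of a subspace \<open>S\<close> by a subspace \<open>N \<subseteq> S\<close>. The fields \<open>mult\<close> and \<open>one\<close> of the
  record type play no role for vector spaces.\<close>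

definition quotient_space ::
    "('x \<Rightarrow>\<^sub>0 'k::field) set \<Rightarrow> ('x \<Rightarrow>\<^sub>0 'k) set \<Rightarrow> ('k, ('x \<Rightarrow>\<^sub>0 'k) set) module" where
  "quotient_space S N =
    \<lparr>carrier = coset N ` S, mult = undefined, one = undefined,
     zero = coset N 0, add = on_cosets2 N (+), smult = (\<lambda>c. on_cosets N (fscale c))\<rparr>"


section \<open>The tensor algebra and its operations\<close>

text \<open>A vector space is given by its scalar multiplication \<open>s\<close>. A word is a list of vectors, and
  the tensor algebra is the free vector space on words modulo multilinearity in the letters.\<close>

definition multilinear_rels ::
    "('k::field \<Rightarrow> 'v::ab_group_add \<Rightarrow> 'v) \<Rightarrow> ('v list \<Rightarrow>\<^sub>0 'k) set" where
  "multilinear_rels s =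
     {gen (u @ (x + y) # v) - gen (u @ x # v) - gen (u @ y # v) | u x y v. True} \<union>
     {gen (u @ s c x # v) - fscale c (gen (u @ x # v)) | u c x v. True}"

abbreviation tensor_ideal ::
    "('k::field \<Rightarrow> 'v::ab_group_add \<Rightarrow> 'v) \<Rightarrow> ('v list \<Rightarrow>\<^sub>0 'k) set" where
  "tensor_ideal s \<equiv> free_space.span (multilinear_rels s)"

definition tensor_algebra ::
    "('k::field \<Rightarrow> 'v::ab_group_add \<Rightarrow> 'v) \<Rightarrow> ('k, ('v list \<Rightarrow>\<^sub>0 'k) set) module" where
  "tensor_algebra s = quotient_space UNIV (tensor_ideal s)"

definition word ::
    "('k::field \<Rightarrow> 'v::ab_group_add \<Rightarrow> 'v) \<Rightarrow> 'v list \<Rightarrow> ('v list \<Rightarrow>\<^sub>0 'k) set" where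
  "word s w = coset (tensor_ideal s) (gen w)"

definition prepend :: "'v \<Rightarrow> ('v list \<Rightarrow>\<^sub>0 'k::field) \<Rightarrow> ('v list \<Rightarrow>\<^sub>0 'k)" where
  "prepend x = lin_ext (\<lambda>w. gen (x # w))"

fun shuffle_words :: "'v list \<Rightarrow> 'v list \<Rightarrow> ('v list \<Rightarrow>\<^sub>0 'k::field)" where
  "shuffle_words [] w = gen w"
| "shuffle_words (x # u) [] = gen (x # u)"
| "shuffle_words (x # u) (y # v) =
     prepend x (shuffle_words u (y # v)) + prepend y (shuffle_words (x # u) v)"

definition shuffle ::
    "('k::field \<Rightarrow> 'v::ab_group_add \<Rightarrow> 'v) \<Rightarrow>
     ('v list \<Rightarrow>\<^sub>0 'k) set \<Rightarrow> ('v list \<Rightarrow>\<^sub>0 'k) set \<Rightarrow> ('v list \<Rightarrow>\<^sub>0 'k) set" where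
  "shuffle s = on_cosets2 (tensor_ideal s) (bilin_ext shuffle_words)"

text \<open>The half-shuffle of the empty word with itself is left unspecified. Bilinear extension then
  makes it a total operation, still well defined on cosets: the relations only involve nonempty
  words.\<close>

fun half_shuffle_words :: "'v list \<Rightarrow> 'v list \<Rightarrow> ('v list \<Rightarrow>\<^sub>0 'k::field)" where
  "half_shuffle_words [] [] = undefined"
| "half_shuffle_words [] (y # v) = 0"
| "half_shuffle_words (x # u) v = prepend x (shuffle_words u v)"

definition half_shuffle ::
    "('k::field \<Rightarrow> 'v::ab_group_add \<Rightarrow> 'v) \<Rightarrow>
     ('v list \<Rightarrow>\<^sub>0 'k) set \<Rightarrow> ('v list \<Rightarrow>\<^sub>0 'k) set \<Rightarrow> ('v list \<Rightarrow>\<^sub>0 'k) set" where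
  "half_shuffle s = on_cosets2 (tensor_ideal s) (bilin_ext half_shuffle_words)"

fun bullet_words :: "('v \<Rightarrow> 'v) \<Rightarrow> 'v list \<Rightarrow> 'v list \<Rightarrow> ('v list \<Rightarrow>\<^sub>0 'k::field)" where
  "bullet_words f [] w' = 0"
| "bullet_words f (x # w) w' =
     prepend x (bullet_words f w w') + prepend (f x) (shuffle_words w w')"

definition bullet ::
    "('k::field \<Rightarrow> 'v::ab_group_add \<Rightarrow> 'v) \<Rightarrow> ('v \<Rightarrow> 'v) \<Rightarrow>
     ('v list \<Rightarrow>\<^sub>0 'k) set \<Rightarrow> ('v list \<Rightarrow>\<^sub>0 'k) set \<Rightarrow> ('v list \<Rightarrow>\<^sub>0 'k) set" where
  "bullet s f = on_cosets2 (tensor_ideal s) (bilin_ext (bullet_words f))"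


section \<open>Tensor products of two vector spaces\<close>

definition bilinear_rels ::
    "('k::field, 'a) module \<Rightarrow> ('k, 'b) module \<Rightarrow> ('a \<times> 'b \<Rightarrow>\<^sub>0 'k) set" where
  "bilinear_rels M N =
     {gen (m \<oplus>\<^bsub>M\<^esub> m', n) - gen (m, n) - gen (m', n) | m m' n.
        m \<in> carrier M \<and> m' \<in> carrier M \<and> n \<in> carrier N} \<union>
     {gen (m, n \<oplus>\<^bsub>N\<^esub> n') - gen (m, n) - gen (m, n') | m n n'.
        m \<in> carrier M \<and> n \<in> carrier N \<and> n' \<in> carrier N} \<union>
     {gen (c \<odot>\<^bsub>M\<^esub> m, n) - fscale c (gen (m, n)) | c m n. m \<in> carrier M \<and> n \<in> carrier N} \<union>
     {gen (m, c \<odot>\<^bsub>N\<^esub> n) - fscale c (gen (m, n)) | c m n. m \<in> carrier M \<and> n \<in> carrier N}"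

definition tensor_product ::
    "('k::field, 'a) module \<Rightarrow> ('k, 'b) module \<Rightarrow> ('k, ('a \<times> 'b \<Rightarrow>\<^sub>0 'k) set) module" where
  "tensor_product M N =
     quotient_space {p. Poly_Mapping.keys p \<subseteq> carrier M \<times> carrier N}
       (free_space.span (bilinear_rels M N))"

text \<open>For linear \<open>g : M \<rightarrow> M'\<close> and \<open>h : N \<rightarrow> N'\<close>, the linear map
  \<open>m \<otimes> n \<mapsto> g m \<otimes> h n\<close> into \<open>M' \<otimes> N'\<close>; for bilinear \<open>g\<close> and \<open>h\<close>, the bilinear map
  \<open>(m \<otimes> n, m' \<otimes> n') \<mapsto> g m m' \<otimes> h n n'\<close>.\<close>

definition tensor_map ::
    "('k::field, 'a) module \<Rightarrow> ('k, 'b) module \<Rightarrow> ('c \<Rightarrow> 'a) \<Rightarrow> ('d \<Rightarrow> 'b) \<Rightarrow>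
     ('c \<times> 'd \<Rightarrow>\<^sub>0 'k) set \<Rightarrow> ('a \<times> 'b \<Rightarrow>\<^sub>0 'k) set" where
  "tensor_map M' N' g h =
     on_cosets (free_space.span (bilinear_rels M' N')) (lin_ext (\<lambda>(m, n). gen (g m, h n)))"

definition tensor_map2 ::
    "('k::field, 'a) module \<Rightarrow> ('k, 'b) module \<Rightarrow> ('c \<Rightarrow> 'e \<Rightarrow> 'a) \<Rightarrow> ('d \<Rightarrow> 'i \<Rightarrow> 'b) \<Rightarrow>
     ('c \<times> 'd \<Rightarrow>\<^sub>0 'k) set \<Rightarrow> ('e \<times> 'i \<Rightarrow>\<^sub>0 'k) set \<Rightarrow> ('a \<times> 'b \<Rightarrow>\<^sub>0 'k) set" where
  "tensor_map2 M' N' g h =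
     on_cosets2 (free_space.span (bilinear_rels M' N'))
       (bilin_ext (\<lambda>(m, n) (m', n'). gen (g m m', h n n')))"

abbreviation tensor_square ::
    "('k::field \<Rightarrow> 'v::ab_group_add \<Rightarrow> 'v) \<Rightarrow>
     ('k, (('v list \<Rightarrow>\<^sub>0 'k) set \<times> ('v list \<Rightarrow>\<^sub>0 'k) set \<Rightarrow>\<^sub>0 'k) set) module" where
  "tensor_square s \<equiv> tensor_product (tensor_algebra s) (tensor_algebra s)"

definition deconcatenation ::
    "('k::field \<Rightarrow> 'v::ab_group_add \<Rightarrow> 'v) \<Rightarrow> ('v list \<Rightarrow>\<^sub>0 'k) set \<Rightarrow>
     (('v list \<Rightarrow>\<^sub>0 'k) set \<times> ('v list \<Rightarrow>\<^sub>0 'k) set \<Rightarrow>\<^sub>0 'k) set" where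
  "deconcatenation s =
     on_cosets (free_space.span (bilinear_rels (tensor_algebra s) (tensor_algebra s)))
       (lin_ext (\<lambda>w. \<Sum>i\<le>length w. gen (word s (take i w), word s (drop i w))))"


section \<open>Com-Pre-Lie algebras\<close>

definition field_ring :: "'k::field ring" where
  "field_ring = \<lparr>carrier = UNIV, mult = (*), one = 1, zero = 0, add = (+)\<rparr>"

definition bilinear_product :: "('k, 'a) module \<Rightarrow> ('a \<Rightarrow> 'a \<Rightarrow> 'a) \<Rightarrow> bool" where
  "bilinear_product A p \<longleftrightarrow>
     (\<forall>a\<in>carrier A. \<forall>b\<in>carrier A. p a b \<in> carrier A) \<and>
     (\<forall>a\<in>carrier A. \<forall>a'\<in>carrier A. \<forall>b\<in>carrier A.
        p (a \<oplus>\<^bsub>A\<^esub> a') b = p a b \<oplus>\<^bsub>A\<^esub> p a' b \<and> p b (a \<oplus>\<^bsub>A\<^esub> a') = p b a \<oplus>\<^bsub>A\<^esub> p b a') \<and>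
     (\<forall>c. \<forall>a\<in>carrier A. \<forall>b\<in>carrier A.
        p (c \<odot>\<^bsub>A\<^esub> a) b = c \<odot>\<^bsub>A\<^esub> p a b \<and> p a (c \<odot>\<^bsub>A\<^esub> b) = c \<odot>\<^bsub>A\<^esub> p a b)"

definition com_pre_lie_algebra ::
    "('k::field, 'a) module \<Rightarrow> ('a \<Rightarrow> 'a \<Rightarrow> 'a) \<Rightarrow> ('a \<Rightarrow> 'a \<Rightarrow> 'a) \<Rightarrow> bool" where
  "com_pre_lie_algebra A sh bl \<longleftrightarrow>
     Module.module field_ring A \<and> bilinear_product A sh \<and> bilinear_product A bl \<and>
     (\<forall>a\<in>carrier A. \<forall>b\<in>carrier A. sh a b = sh b a) \<and>
     (\<forall>a\<in>carrier A. \<forall>b\<in>carrier A. \<forall>c\<in>carrier A. sh (sh a b) c = sh a (sh b c)) \<and>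
     (\<forall>a\<in>carrier A. \<forall>b\<in>carrier A. \<forall>c\<in>carrier A.
        bl (sh a b) c = sh (bl a c) b \<oplus>\<^bsub>A\<^esub> sh a (bl b c)) \<and>
     (\<forall>a\<in>carrier A. \<forall>b\<in>carrier A. \<forall>c\<in>carrier A.
        bl (bl a b) c \<ominus>\<^bsub>A\<^esub> bl a (bl b c) = bl (bl a c) b \<ominus>\<^bsub>A\<^esub> bl a (bl c b))"

end

theory Submission imports Defs begin

text \<open>All four identities hold before the tensor relations are imposed: they are identities between formal
linear combinations of words, for an arbitrary map \<open>f\<close> on letters. On formal words they follow by
induction on length, because both the shuffle and the product \<open>\<bullet>\<close> are described by the first letter:
a shuffle starts with the first letter of one of its factors, and \<open>xw \<bullet> c = x(w \<bullet> c) + f(x)(w \<squnion> c)\<close>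
says that \<open>w \<bullet> c\<close> is the sum over the letters \<open>x\<close> of \<open>w\<close> of the words in which \<open>x\<close> is replaced by \<open>f(x)\<close>
and \<open>c\<close> is shuffled into what follows. From this:

\<^item> \<open>- \<bullet> c\<close> is a derivation of the shuffle product and of the half-shuffle (\<open>bul_shuf\<close>,
  \<open>bul_half_shuf\<close>), since the letter replaced in a shuffle of \<open>a\<close> and \<open>b\<close> comes from one of the two;

\<^item> the associator \<open>(a \<bullet> b) \<bullet> c - a \<bullet> (b \<bullet> c)\<close> is symmetric in \<open>b\<close> and \<open>c\<close>
  (\<open>bul_pre_lie\<close>): by the derivation property, the part of \<open>(a \<bullet> b) \<bullet> c\<close> in which \<open>c\<close> acts inside \<open>b\<close>
  is \<open>a \<bullet> (b \<bullet> c)\<close>, and in the rest both \<open>b\<close> and \<open>c\<close> act on \<open>a\<close>, where commutativity and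
  associativity of the shuffle make their order irrelevant;

\<^item> cutting a word of \<open>a \<bullet> b\<close> leaves the replaced letter either to the right of the cut, so that \<open>b\<close> acts on
  the right-hand part of \<open>a\<close> only, or to its left, so that the cut also divides \<open>b\<close>, and the two right-hand parts are
  shuffled (\<open>splits_bul\<close>). This uses that deconcatenation is multiplicative for the shuffle
  (\<open>splits_shuf\<close>).

What remains is descent to the quotients. Every operation is multilinear in the letters of
its arguments modulo the tensor relations (\<open>multilinear_shuffle_words\<close>, \<open>multilinear_bullet_words\<close> and their
relatives), and only there the linearity of \<open>f\<close> enters. Hence each operation on classes can be computed on
representatives. For the tensor square, the class of \<open>a \<otimes> b\<close> is the expansion of \<open>a\<close> and \<open>b\<close> into pairs of
words (\<open>tensor_expand\<close>), which carries the formal identity \<open>splits_bul\<close> over to classes.\<close>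

section \<open>Linear maps between free vector spaces\<close>

abbreviation free_linear :: "(('x \<Rightarrow>\<^sub>0 'k::field) \<Rightarrow> ('y \<Rightarrow>\<^sub>0 'k)) \<Rightarrow> bool" where
  "free_linear \<equiv> module_hom fscale fscale"

lemma free_linear_iff:
  "free_linear F \<longleftrightarrow> (\<forall>p q. F (p + q) = F p + F q) \<and> (\<forall>c p. F (fscale c p) = fscale c (F p))"
  by (simp add: module_hom_iff free_space.module_axioms)

text \<open>Sums over the supports of different arguments become comparable over a common finite index set.\<close>

lemma lin_ext_superset:
  assumes "finite A" "Poly_Mapping.keys p \<subseteq> A"
  shows "lin_ext g p = (\<Sum>x\<in>A. fscale (Poly_Mapping.lookup p x) (g x))"
  unfolding lin_ext_def
  by (rule sum.mono_neutral_left) (use assms in \<open>auto simp: in_keys_iff\<close>)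

lemma lin_ext_add [simp]: "lin_ext g (p + q) = lin_ext g p + lin_ext g q"
proof -
  let ?A = "Poly_Mapping.keys p \<union> Poly_Mapping.keys q"
  have "lin_ext g r = (\<Sum>x\<in>?A. fscale (Poly_Mapping.lookup r x) (g x))"
    if "r \<in> {p, q, p + q}" for r
    by (rule lin_ext_superset) (use that Poly_Mapping.keys_add[of p q] in auto)
  then show ?thesis
    by (simp add: lookup_add free_space.scale_left_distrib sum.distrib)
qed

lemma lin_ext_scale [simp]: "lin_ext g (fscale c p) = fscale c (lin_ext g p)"
proof -
  have "lin_ext g (fscale c p)
      = (\<Sum>x\<in>Poly_Mapping.keys p. fscale (Poly_Mapping.lookup (fscale c p) x) (g x))"
    by (rule lin_ext_superset) (auto simp: in_keys_iff)
  then show ?thesis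
    by (simp add: lin_ext_def free_space.scale_sum_right)
qed

lemma lin_ext_gen [simp]: "lin_ext g (gen x) = g x"
  by (simp add: lin_ext_def)

lemma free_linear_lin_ext: "free_linear (lin_ext g)"
  by (simp add: free_linear_iff)

lemmas lin_ext_zero [simp] = module_hom.zero [OF free_linear_lin_ext]
  and lin_ext_diff [simp] = module_hom.diff [OF free_linear_lin_ext]
  and lin_ext_sum = module_hom.sum [OF free_linear_lin_ext]

lemma bilin_ext_add_left [simp]: "bilin_ext g (p + p') q = bilin_ext g p q + bilin_ext g p' q"
  and bilin_ext_scale_left [simp]: "bilin_ext g (fscale c p) q = fscale c (bilin_ext g p q)"
  and bilin_ext_zero_left [simp]: "bilin_ext g 0 q = 0"
  and bilin_ext_diff_left [simp]: "bilin_ext g (p - p') q = bilin_ext g p q - bilin_ext g p' q"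
  and bilin_ext_gen_left [simp]: "bilin_ext g (gen x) q = lin_ext (g x) q"
  by (simp_all add: bilin_ext_def)

lemma bilin_ext_swap: "bilin_ext g p q = lin_ext (\<lambda>y. lin_ext (\<lambda>x. g x y) p) q"
  unfolding bilin_ext_def lin_ext_def
  by (simp add: free_space.scale_sum_right mult.commute sum.swap[of _ "Poly_Mapping.keys q"])

lemma bilin_ext_add_right [simp]: "bilin_ext g p (q + q') = bilin_ext g p q + bilin_ext g p q'"
  and bilin_ext_scale_right [simp]: "bilin_ext g p (fscale c q) = fscale c (bilin_ext g p q)"
  and bilin_ext_zero_right [simp]: "bilin_ext g p 0 = 0"
  and bilin_ext_diff_right [simp]: "bilin_ext g p (q - q') = bilin_ext g p q - bilin_ext g p q'"
  and bilin_ext_gen_right: "bilin_ext g p (gen y) = lin_ext (\<lambda>x. g x y) p"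
  by (simp_all add: bilin_ext_swap)

lemma gen_decomposition:
  "p = (\<Sum>x\<in>Poly_Mapping.keys p. fscale (Poly_Mapping.lookup p x) (gen x))"
  by (rule poly_mapping_eqI)
    (simp add: lookup_sum lookup_single when_def in_keys_iff if_distrib[where f = "(*) _"]
      cong: if_cong)

text \<open>By linearity, \<open>F p\<close> is a combination of the values of \<open>F\<close> on the support of \<open>p\<close>. All congruences modulo
tensor relations are reduced to generators in this way; \<open>N = {0}\<close> gives the uniqueness of a linear map with
prescribed values on the generators.\<close>

lemma linear_in_subspace:
  assumes "free_linear F" "free_space.subspace N" "\<And>x. x \<in> Poly_Mapping.keys p \<Longrightarrow> F (gen x) \<in> N"
  shows "F p \<in> N"
proof -
  have "F p = (\<Sum>x\<in>Poly_Mapping.keys p. fscale (Poly_Mapping.lookup p x) (F (gen x)))"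
    by (subst gen_decomposition)
      (simp add: module_hom.sum[OF assms(1)] module_hom.scale[OF assms(1)])
  also have "\<dots> \<in> N"
    using assms(2,3) by (intro free_space.subspace_sum free_space.subspace_scale)
  finally show ?thesis .
qed

lemma linear_eqI:
  assumes "free_linear F" "free_linear G" "\<And>x. F (gen x) = G (gen x)"
  shows "F p = G p"
proof -
  have "F p - G p \<in> {0}"
  proof (rule linear_in_subspace[where F = "\<lambda>p. F p - G p"])
    show "free_linear (\<lambda>p. F p - G p)"
      using assms(1,2) by (auto simp: free_linear_iff algebra_simps)
  qed (use assms(3) in auto)
  then show ?thesis by simp
qed

text \<open>The following closure rules prove linearity in a variable by following the syntax of a term. Together with
\<open>linear_eqI\<close> they reduce a multilinear identity to one between words.\<close>

lemma free_linear_id: "free_linear (\<lambda>p. p)"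
  by (simp add: free_linear_iff)

lemma free_linear_zero: "free_linear (\<lambda>p. 0)"
  by (simp add: free_linear_iff)

lemma free_linear_add:
  "free_linear F \<Longrightarrow> free_linear G \<Longrightarrow> free_linear (\<lambda>p. F p + G p)"
  by (simp add: free_linear_iff algebra_simps)

lemma free_linear_diff:
  "free_linear F \<Longrightarrow> free_linear G \<Longrightarrow> free_linear (\<lambda>p. F p - G p)"
  by (simp add: free_linear_iff algebra_simps)

lemma free_linear_comp_lin_ext: "free_linear F \<Longrightarrow> free_linear (\<lambda>p. lin_ext g (F p))"
  by (simp add: free_linear_iff)

lemma free_linear_bilin_ext_left: "free_linear F \<Longrightarrow> free_linear (\<lambda>p. bilin_ext g (F p) q)"
  by (simp add: free_linear_iff)

lemma free_linear_bilin_ext_right: "free_linear F \<Longrightarrow> free_linear (\<lambda>p. bilin_ext g q (F p))"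
  by (simp add: free_linear_iff)

lemma free_linear_prepend: "free_linear F \<Longrightarrow> free_linear (\<lambda>p. prepend x (F p))"
  by (simp add: prepend_def free_linear_comp_lin_ext)

lemmas free_linear_intros =
  free_linear_id free_linear_zero free_linear_add free_linear_diff free_linear_comp_lin_ext
  free_linear_bilin_ext_left free_linear_bilin_ext_right free_linear_prepend

section \<open>Shuffles of formal words\<close>

lemma prepend_add [simp]: "prepend x (p + q) = prepend x p + prepend x q"
  and prepend_diff [simp]: "prepend x (p - q) = prepend x p - prepend x q"
  and prepend_zero [simp]: "prepend x 0 = 0"
  and prepend_scale [simp]: "prepend x (fscale c p) = fscale c (prepend x p)"
  by (simp_all add: prepend_def)

text \<open>Replacing the letter in front of a word by the linear map \<open>prepend x\<close> makes the recursion equations of the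
operations on words applicable to linear combinations, as in the lemmas \<open>shuf_prepend\<close>, \<open>bul_prepend\<close> and
\<open>half_shuf_prepend\<close>.\<close>

lemma gen_Cons: "gen (x # w) = prepend x (gen w)"
  by (simp add: prepend_def)

abbreviation shuf :: "('v list \<Rightarrow>\<^sub>0 'k::field) \<Rightarrow> ('v list \<Rightarrow>\<^sub>0 'k) \<Rightarrow> ('v list \<Rightarrow>\<^sub>0 'k)" where
  "shuf \<equiv> bilin_ext shuffle_words"

lemma shuffle_words_Nil_right [simp]: "shuffle_words w [] = gen w"
  by (cases w) auto

lemma shuf_Nil_left [simp]: "shuf (gen []) p = p"
  by (rule linear_eqI[of "\<lambda>p. shuf (gen []) p"]) (intro free_linear_intros | simp)+

lemma shuf_Nil_right [simp]: "shuf p (gen []) = p"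
  by (rule linear_eqI[of "\<lambda>p. shuf p (gen [])"]) (intro free_linear_intros | simp)+

lemma shuf_prepend:
  "shuf (prepend x p) (prepend y q)
     = prepend x (shuf p (prepend y q)) + prepend y (shuf (prepend x p) q)"
  by (rule linear_eqI[of _ _ p], (intro free_linear_intros)+,
      rule linear_eqI[of _ _ q], (intro free_linear_intros)+)
    (simp flip: gen_Cons)

lemma shuffle_words_commute: "shuffle_words u v = shuffle_words v u"
  by (induction u v rule: shuffle_words.induct) (auto simp: add.commute)

lemma shuf_commute: "shuf p q = shuf q p"
  by (simp add: bilin_ext_swap[of _ p] bilin_ext_def[of _ q] shuffle_words_commute)

text \<open>Both sides are sums of three terms, according to which of \<open>u\<close>, \<open>v\<close>, \<open>w\<close> provides the first letter, and
corresponding terms agree by induction on the total length.\<close>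

lemma shuf_assoc_words:
  "shuf (shuf (gen u) (gen v)) (gen w) = shuf (gen u) (shuf (gen v) (gen w))"
proof (induction "length u + length v + length w" arbitrary: u v w rule: less_induct)
  case less
  show ?case
  proof (cases "u = [] \<or> v = [] \<or> w = []")
    case True
    then show ?thesis
      by (elim disjE) (simp_all del: bilin_ext_gen_left)
  next
    case False
    then obtain x u' y v' z w' where uvw: "u = x # u'" "v = y # v'" "w = z # w'"
      by (metis list.exhaust)
    show ?thesis
      \<comment> \<open>The letter is prepended to the induction hypotheses beforehand, since simplification
        expands \<open>shuf\<close> inside \<open>prepend\<close> in the goal.\<close>
      using less[of u' v w, THEN arg_cong[where f = "prepend x"]]
        less[of u v' w, THEN arg_cong[where f = "prepend y"]]
        less[of u v w', THEN arg_cong[where f = "prepend z"]]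
      by (simp del: bilin_ext_gen_left add: uvw gen_Cons shuf_prepend algebra_simps)
  qed
qed

lemma shuf_assoc: "shuf (shuf p q) r = shuf p (shuf q r)"
  by (rule linear_eqI[of _ _ p], (intro free_linear_intros)+,
      rule linear_eqI[of _ _ q], (intro free_linear_intros)+,
      rule linear_eqI[of _ _ r], (intro free_linear_intros)+)
    (rule shuf_assoc_words)

section \<open>The product associated to an endomorphism\<close>

abbreviation bul ::
    "('v \<Rightarrow> 'v) \<Rightarrow> ('v list \<Rightarrow>\<^sub>0 'k::field) \<Rightarrow> ('v list \<Rightarrow>\<^sub>0 'k) \<Rightarrow> ('v list \<Rightarrow>\<^sub>0 'k)" where
  "bul f \<equiv> bilin_ext (bullet_words f)"

lemma bul_Nil [simp]: "bul f (gen []) p = 0"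
  by (rule linear_eqI[of "\<lambda>p. bul f (gen []) p"]) (intro free_linear_intros | simp)+

lemma bul_prepend: "bul f (prepend x p) q = prepend x (bul f p q) + prepend (f x) (shuf p q)"
  by (rule linear_eqI[of _ _ p], (intro free_linear_intros)+,
      rule linear_eqI[of _ _ q], (intro free_linear_intros)+)
    (simp flip: gen_Cons)

text \<open>For \<open>xu\<close> and \<open>yv\<close>, compare the terms by their first letter. Those starting with \<open>x\<close> or \<open>y\<close> agree by
induction. Those starting with \<open>f(x)\<close> are \<open>f(x)((u \<squnion> yv) \<squnion> c)\<close> on the left and
\<open>f(x)((u \<squnion> c) \<squnion> yv)\<close> on the right, and similarly for \<open>f(y)\<close>; they agree because the shuffle
product is commutative and associative.\<close>

lemma bul_shuf_words:
  "bul f (shuf (gen u) (gen v)) c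
     = shuf (bul f (gen u) c) (gen v) + shuf (gen u) (bul f (gen v) c)"
proof (induction u v rule: shuffle_words.induct)
  case (3 x u y v)
  note IH = this[unfolded gen_Cons]
  show ?case
    unfolding gen_Cons
    by (simp del: bilin_ext_gen_left add: shuf_prepend bul_prepend IH shuf_assoc)
      (simp del: bilin_ext_gen_left add: algebra_simps shuf_commute[of c] shuf_assoc)
qed (simp_all del: bilin_ext_gen_left)

lemma bul_shuf: "bul f (shuf p q) r = shuf (bul f p r) q + shuf p (bul f q r)"
  by (rule linear_eqI[of _ _ p], (intro free_linear_intros)+,
      rule linear_eqI[of _ _ q], (intro free_linear_intros)+)
    (rule bul_shuf_words)

text \<open>For the word \<open>xw\<close>, the associator consists of \<open>x\<close> in front of the associator of \<open>w\<close>, which is symmetric by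
induction, of \<open>f(x)((w \<bullet> p) \<squnion> q + (w \<bullet> q) \<squnion> p)\<close>, and of \<open>f(f(x))((w \<squnion> p) \<squnion> q)\<close>.
The term \<open>f(x)(w \<squnion> (p \<bullet> q))\<close> cancels, because \<open>- \<bullet> q\<close> is a derivation of \<open>w \<squnion> p\<close>.\<close>

lemma bul_pre_lie_words:
  "bul f (bul f (gen w) p) q - bul f (gen w) (bul f p q)
     = bul f (bul f (gen w) q) p - bul f (gen w) (bul f q p)"
proof (induction w)
  case (Cons x w)
  have "prepend x (bul f (bul f (gen w) p) q) - prepend x (bul f (gen w) (bul f p q))
      = prepend x (bul f (bul f (gen w) q) p) - prepend x (bul f (gen w) (bul f q p))"
    by (metis Cons prepend_diff)
  then show ?case
    by (simp del: bilin_ext_gen_left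
        add: gen_Cons bul_prepend bul_shuf shuf_assoc shuf_commute[of q p] algebra_simps)
qed (simp del: bilin_ext_gen_left)

lemma bul_pre_lie:
  "bul f (bul f p q) r - bul f p (bul f q r) = bul f (bul f p r) q - bul f p (bul f r q)"
  by (rule linear_eqI[of _ _ p], (intro free_linear_intros)+) (rule bul_pre_lie_words)

abbreviation half_shuf :: "('v list \<Rightarrow>\<^sub>0 'k::field) \<Rightarrow> ('v list \<Rightarrow>\<^sub>0 'k) \<Rightarrow> ('v list \<Rightarrow>\<^sub>0 'k)" where
  "half_shuf \<equiv> bilin_ext half_shuffle_words"

lemma half_shuf_prepend: "half_shuf (prepend x p) q = prepend x (shuf p q)"
  by (rule linear_eqI[of _ _ p], (intro free_linear_intros)+,
      rule linear_eqI[of _ _ q], (intro free_linear_intros)+)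
    (simp flip: gen_Cons)

lemma half_shuf_Nil_prepend: "half_shuf (gen []) (prepend x p) = 0"
  by (rule linear_eqI[of _ _ p], (intro free_linear_intros)+) (simp flip: gen_Cons)

text \<open>If \<open>u\<close> is empty, both sides vanish, since \<open>v \<bullet> p\<close> is a combination of nonempty words when \<open>v\<close> is
nonempty. Otherwise \<open>xu' \<prec> v = x(u' \<squnion> v)\<close>, and the claim is the derivation property of the shuffle
product behind the letters \<open>x\<close> and \<open>f(x)\<close>.\<close>

lemma bul_half_shuf:
  assumes "(u, v) \<noteq> ([], [])"
  shows "bul f (half_shuf (gen u) (gen v)) p
     = half_shuf (bul f (gen u) p) (gen v) + half_shuf (gen u) (bul f (gen v) p)"
proof (cases u)
  case Nil
  with assms obtain y v' where "v = y # v'"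
    by (cases v) auto
  with Nil show ?thesis
    by (simp del: bilin_ext_gen_left add: gen_Cons half_shuf_Nil_prepend bul_prepend)
next
  case (Cons x u')
  then show ?thesis
    by (simp del: bilin_ext_gen_left add: gen_Cons half_shuf_prepend bul_prepend bul_shuf
        shuf_assoc shuf_commute[of p])
qed

section \<open>Deconcatenation of formal words\<close>

abbreviation tens :: "('x \<Rightarrow>\<^sub>0 'k::field) \<Rightarrow> ('y \<Rightarrow>\<^sub>0 'k) \<Rightarrow> ('x \<times> 'y \<Rightarrow>\<^sub>0 'k)" where
  "tens \<equiv> bilin_ext (\<lambda>u v. gen (u, v))"

definition splits :: "'v list \<Rightarrow> ('v list \<times> 'v list \<Rightarrow>\<^sub>0 'k::field)" where
  "splits w = (\<Sum>i\<le>length w. gen (take i w, drop i w))"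

abbreviation prepend_left ::
    "'v \<Rightarrow> ('v list \<times> 'v list \<Rightarrow>\<^sub>0 'k::field) \<Rightarrow> ('v list \<times> 'v list \<Rightarrow>\<^sub>0 'k)" where
  "prepend_left x \<equiv> lin_ext (\<lambda>(u, v). gen (x # u, v))"

text \<open>The shuffle product of the tensor square, \<open>(u \<otimes> u') (v \<otimes> v') = (u \<squnion> v) \<otimes> (u' \<squnion> v')\<close>.
With \<open>\<bullet>\<close> in the left factor it becomes \<open>bul_shuf2\<close>.\<close>

abbreviation shuf_shuf ::
    "('v list \<times> 'v list \<Rightarrow>\<^sub>0 'k::field) \<Rightarrow> ('v list \<times> 'v list \<Rightarrow>\<^sub>0 'k)
       \<Rightarrow> ('v list \<times> 'v list \<Rightarrow>\<^sub>0 'k)" where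
  "shuf_shuf \<equiv> bilin_ext (\<lambda>(u, u') (v, v'). tens (shuffle_words u v) (shuffle_words u' v'))"

abbreviation bul_shuf2 ::
    "('v \<Rightarrow> 'v) \<Rightarrow> ('v list \<times> 'v list \<Rightarrow>\<^sub>0 'k::field) \<Rightarrow> ('v list \<times> 'v list \<Rightarrow>\<^sub>0 'k)
       \<Rightarrow> ('v list \<times> 'v list \<Rightarrow>\<^sub>0 'k)" where
  "bul_shuf2 f \<equiv> bilin_ext (\<lambda>(u, u') (v, v'). tens (bullet_words f u v) (shuffle_words u' v'))"

abbreviation id_bul ::
    "('v \<Rightarrow> 'v) \<Rightarrow> ('v list \<times> 'v list \<Rightarrow>\<^sub>0 'k::field) \<Rightarrow> ('v list \<Rightarrow>\<^sub>0 'k)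
       \<Rightarrow> ('v list \<times> 'v list \<Rightarrow>\<^sub>0 'k)" where
  "id_bul f \<equiv> bilin_ext (\<lambda>(u, v) w. tens (gen u) (bullet_words f v w))"

text \<open>A letter at the front of a word stays in the left part of every cut, except for the cut before it. In Sweedler
terms, \<open>\<Delta>(xw) = \<emptyset> \<otimes> xw + x w\<^sub>1 \<otimes> w\<^sub>2\<close>. Hence each product on pairs of words is computed below on pairs
of the form \<open>\<emptyset> \<otimes> p\<close> and on pairs whose left part starts with a given letter.\<close>

lemma tens_prepend: "tens (prepend x p) q = prepend_left x (tens p q)"
  by (rule linear_eqI[of _ _ p], (intro free_linear_intros)+,
      rule linear_eqI[of _ _ q], (intro free_linear_intros)+)
    (simp flip: gen_Cons)

lemma tens_gen_Cons: "lin_ext (\<lambda>v. gen (x # u, v)) q = prepend_left x (lin_ext (\<lambda>v. gen (u, v)) q)"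
  using tens_prepend[of x "gen u" q] by (simp flip: gen_Cons)

lemma splits_Nil: "splits [] = tens (gen []) (gen [])"
  by (simp add: splits_def)

lemma splits_Cons:
  "splits (x # w) = tens (gen []) (prepend x (gen w)) + prepend_left x (splits w)"
  by (simp add: splits_def sum.atMost_Suc_shift lin_ext_sum flip: gen_Cons del: sum.atMost_Suc)

lemma lin_ext_splits_prepend:
  "lin_ext splits (prepend x p) = tens (gen []) (prepend x p) + prepend_left x (lin_ext splits p)"
  by (rule linear_eqI[of _ _ p], (intro free_linear_intros)+)
    (simp add: splits_Cons flip: gen_Cons)

lemma shuf_shuf_prepend_left:
  "shuf_shuf (prepend_left x s) (prepend_left y t)
     = prepend_left x (shuf_shuf s (prepend_left y t))
       + prepend_left y (shuf_shuf (prepend_left x s) t)"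
  by (rule linear_eqI[of _ _ s], (intro free_linear_intros)+,
      rule linear_eqI[of _ _ t], (intro free_linear_intros)+)
    (auto simp: tens_prepend split: prod.split)

lemma shuf_shuf_prepend_left_Nil:
  "shuf_shuf (prepend_left x s) (tens (gen []) q)
     = prepend_left x (shuf_shuf s (tens (gen []) q))"
  by (rule linear_eqI[of _ _ s], (intro free_linear_intros)+,
      rule linear_eqI[of _ _ q], (intro free_linear_intros)+)
    (auto simp: tens_gen_Cons split: prod.split)

lemma shuf_shuf_Nil_prepend_left:
  "shuf_shuf (tens (gen []) q) (prepend_left x s)
     = prepend_left x (shuf_shuf (tens (gen []) q) s)"
  by (rule linear_eqI[of _ _ s], (intro free_linear_intros)+,
      rule linear_eqI[of _ _ q], (intro free_linear_intros)+)
    (auto simp: tens_gen_Cons split: prod.split)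

lemma shuf_shuf_Nil_Nil:
  "shuf_shuf (tens (gen []) p) (tens (gen []) q) = tens (gen []) (shuf p q)"
  by (rule linear_eqI[of _ _ p], (intro free_linear_intros)+,
      rule linear_eqI[of _ _ q], (intro free_linear_intros)+) simp

lemma shuf_shuf_unit_left: "shuf_shuf (gen ([], [])) t = t"
  by (rule linear_eqI[of _ _ t], (intro free_linear_intros)+) (auto split: prod.split)

lemma shuf_shuf_unit_right: "shuf_shuf t (gen ([], [])) = t"
  by (rule linear_eqI[of _ _ t], (intro free_linear_intros)+) (auto split: prod.split)

text \<open>Deconcatenation is multiplicative for the shuffle product: for \<open>xu\<close> and \<open>yv\<close>, the trivial cuts give
\<open>\<emptyset> \<otimes> (xu \<squnion> yv)\<close>, and the left parts of all other cuts start with \<open>x\<close> or with \<open>y\<close>, where the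
induction hypotheses for \<open>(u, yv)\<close> and \<open>(xu, v)\<close> apply.\<close>

lemma splits_shuffle_words:
  "lin_ext splits (shuf (gen u) (gen v)) = shuf_shuf (splits u) (splits v)"
proof (induction u v rule: shuffle_words.induct)
  case (1 w)
  then show ?case
    by (simp del: bilin_ext_gen_left
        add: shuf_shuf_unit_left splits_def[of "[]"])
next
  case (2 x u)
  then show ?case
    by (simp del: bilin_ext_gen_left
        add: shuf_shuf_unit_right splits_def[of "[]"])
next
  case (3 x u y v)
  then show ?case
    unfolding splits_Cons gen_Cons
    by (simp del: bilin_ext_gen_left lin_ext_gen add: shuf_prepend lin_ext_splits_prepend
        shuf_shuf_prepend_left shuf_shuf_prepend_left_Nil shuf_shuf_Nil_prepend_left
        shuf_shuf_Nil_Nil)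
qed

lemma splits_shuf:
  "lin_ext splits (shuf p q) = shuf_shuf (lin_ext splits p) (lin_ext splits q)"
  by (rule linear_eqI[of _ _ p], (intro free_linear_intros)+,
      rule linear_eqI[of _ _ q], (intro free_linear_intros)+)
    (simp only: splits_shuffle_words lin_ext_gen)

lemma bul_shuf2_prepend_left:
  "bul_shuf2 f (prepend_left x s) t
     = prepend_left x (bul_shuf2 f s t) + prepend_left (f x) (shuf_shuf s t)"
  by (rule linear_eqI[of _ _ s], (intro free_linear_intros)+,
      rule linear_eqI[of _ _ t], (intro free_linear_intros)+)
    (auto simp: tens_prepend split: prod.split)

lemma bul_shuf2_Nil: "bul_shuf2 f (tens (gen []) p) t = 0"
  by (rule linear_eqI[of _ _ p], (intro free_linear_intros)+,
      rule linear_eqI[of _ _ t], (intro free_linear_intros)+)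
    (auto split: prod.split)

lemma id_bul_prepend_left: "id_bul f (prepend_left x s) q = prepend_left x (id_bul f s q)"
  by (rule linear_eqI[of _ _ s], (intro free_linear_intros)+,
      rule linear_eqI[of _ _ q], (intro free_linear_intros)+)
    (auto simp: tens_gen_Cons split: prod.split)

lemma id_bul_Nil: "id_bul f (tens (gen []) p) q = tens (gen []) (bul f p q)"
  by (rule linear_eqI[of _ _ p], (intro free_linear_intros)+,
      rule linear_eqI[of _ _ q], (intro free_linear_intros)+) simp

text \<open>For \<open>xw\<close>, the summand \<open>x(w \<bullet> q)\<close> is covered by the induction hypothesis. Cutting the summand
\<open>f(x)(w \<squnion> q)\<close> before its first letter gives, together with the same cut of \<open>x(w \<bullet> q)\<close>, the term
\<open>\<emptyset> \<otimes> (xw \<bullet> q)\<close>; cutting it elsewhere deconcatenates \<open>w \<squnion> q\<close>, to which multiplicativity applies.\<close>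

lemma splits_bul_words:
  "lin_ext splits (bul f (gen w) q)
     = id_bul f (splits w) q + bul_shuf2 f (splits w) (lin_ext splits q)"
proof (induction w)
  case Nil
  then show ?case
    by (simp del: bilin_ext_gen_left add: splits_Nil bul_shuf2_Nil id_bul_Nil)
next
  case (Cons x w)
  then show ?case
    unfolding splits_Cons gen_Cons
    by (simp del: bilin_ext_gen_left lin_ext_gen add: bul_prepend lin_ext_splits_prepend
        bul_shuf2_prepend_left bul_shuf2_Nil id_bul_prepend_left id_bul_Nil splits_shuf)
      simp
qed

lemma splits_bul:
  "lin_ext splits (bul f p q)
     = id_bul f (lin_ext splits p) q + bul_shuf2 f (lin_ext splits p) (lin_ext splits q)"
  by (rule linear_eqI[of _ _ p], (intro free_linear_intros)+)
    (simp only: splits_bul_words lin_ext_gen)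

section \<open>Quotient spaces\<close>

lemma mem_coset: "q \<in> coset N p \<longleftrightarrow> q - p \<in> N"
  by (simp add: coset_def)

lemma coset_eqI:
  assumes "free_space.subspace N" "p - q \<in> N"
  shows "coset N p = coset N q"
proof (rule Set.set_eqI)
  fix r
  have "r - p + (p - q) \<in> N" if "r - p \<in> N"
    using assms that by (blast intro: free_space.subspace_add)
  moreover have "r - q - (p - q) \<in> N" if "r - q \<in> N"
    using assms that by (blast intro: free_space.subspace_diff)
  ultimately show "r \<in> coset N p \<longleftrightarrow> r \<in> coset N q"
    by (auto simp: mem_coset)
qed

lemma on_cosets_coset:
  assumes N: "free_space.subspace N" and F: "free_linear F" and "0 \<in> M"
    and M: "\<And>r. r \<in> M \<Longrightarrow> F r \<in> N"
  shows "on_cosets N F (coset M p) = coset N (F p)"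
proof -
  have "coset N (F q) = coset N (F p)" if "q \<in> coset M p" for q
    using M[of "q - p"] that by (intro coset_eqI N) (simp add: mem_coset module_hom.diff[OF F])
  moreover have "p \<in> coset M p"
    using \<open>0 \<in> M\<close> by (simp add: mem_coset)
  ultimately show ?thesis
    unfolding on_cosets_def by blast
qed

text \<open>From \<open>G p' q' - G p q = G (p' - p) q' + G p (q' - q)\<close>: relations in the first argument are tested against
all representatives \<open>q'\<close>, those in the second against \<open>p\<close> alone. Restricting \<open>q'\<close> to the class of \<open>q\<close>
matters for tensor products of modules, where only generators from the carriers behave linearly.\<close>

lemma on_cosets2_coset:
  assumes N: "free_space.subspace N" and "0 \<in> M" "0 \<in> M'"
    and diff: "\<And>p p' q. G (p - p') q = G p q - G p' q" "\<And>p q q'. G p (q - q') = G p q - G p q'"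
    and left: "\<And>r q'. r \<in> M \<Longrightarrow> q' \<in> coset M' q \<Longrightarrow> G r q' \<in> N"
    and right: "\<And>r. r \<in> M' \<Longrightarrow> G p r \<in> N"
  shows "on_cosets2 N G (coset M p) (coset M' q) = coset N (G p q)"
proof -
  have "coset N (G p' q') = coset N (G p q)" if "p' \<in> coset M p" "q' \<in> coset M' q" for p' q'
  proof (rule coset_eqI[OF N])
    have "G (p' - p) q' + G p (q' - q) \<in> N"
      using that by (intro free_space.subspace_add[OF N] left right) (auto simp: mem_coset)
    then show "G p' q' - G p q \<in> N"
      by (simp add: diff)
  qed
  moreover have "p \<in> coset M p" "q \<in> coset M' q"
    using assms(2,3) by (simp_all add: mem_coset)
  ultimately show ?thesis
    unfolding on_cosets2_def by blast
qed

lemma carrier_quotient_space: "carrier (quotient_space S N) = coset N ` S"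
  by (simp add: quotient_space_def)

lemma zero_quotient_space: "\<zero>\<^bsub>quotient_space S N\<^esub> = coset N 0"
  by (simp add: quotient_space_def)

lemma add_quotient_space:
  assumes "free_space.subspace N"
  shows "coset N p \<oplus>\<^bsub>quotient_space S N\<^esub> coset N q = coset N (p + q)"
proof -
  have "on_cosets2 N (+) (coset N p) (coset N q) = coset N (p + q)"
    unfolding on_cosets2_def
  proof (intro Set.set_eqI iffI)
    fix r assume "r \<in> (\<Union>p'\<in>coset N p. \<Union>q'\<in>coset N q. coset N (p' + q'))"
    then obtain p' q' where "p' - p \<in> N" "q' - q \<in> N" "r - (p' + q') \<in> N"
      by (auto simp: mem_coset)
    then have "(p' - p) + (q' - q) + (r - (p' + q')) \<in> N"
      using assms by (blast intro: free_space.subspace_add)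
    then show "r \<in> coset N (p + q)"
      by (simp add: mem_coset algebra_simps)
  qed (use free_space.subspace_0[OF assms] in \<open>force simp: mem_coset\<close>)
  then show ?thesis
    by (simp add: quotient_space_def)
qed

lemma smult_quotient_space:
  assumes "free_space.subspace N"
  shows "c \<odot>\<^bsub>quotient_space S N\<^esub> coset N p = coset N (fscale c p)"
proof -
  have "on_cosets N (fscale c) (coset N p) = coset N (fscale c p)"
    using assms by (intro on_cosets_coset)
      (auto simp: free_linear_iff free_space.scale_right_distrib mult.commute
        intro: free_space.subspace_scale free_space.subspace_0)
  then show ?thesis
    by (simp add: quotient_space_def)
qed

lemma module_quotient_space:
  assumes N: "free_space.subspace N" and S: "free_space.subspace S"
  shows "Module.module field_ring (quotient_space S N)"
proof -
  note simps = carrier_quotient_space zero_quotient_space add_quotient_space[OF N]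
    smult_quotient_space[OF N]
  have "cring (field_ring :: 'a ring)"
  proof (rule cringI)
    show "abelian_group (field_ring :: 'a ring)"
      by (rule abelian_groupI) (auto simp: field_ring_def intro: left_minus)
    show "comm_monoid (field_ring :: 'a ring)"
      by (rule comm_monoidI) (auto simp: field_ring_def)
  qed (auto simp: field_ring_def distrib_right)
  moreover have "abelian_group (quotient_space S N)"
  proof (rule abelian_groupI)
    fix a assume "a \<in> carrier (quotient_space S N)"
    then obtain p where "p \<in> S" "a = coset N p"
      by (auto simp: simps)
    then show "\<exists>b\<in>carrier (quotient_space S N). b \<oplus>\<^bsub>quotient_space S N\<^esub> a = \<zero>\<^bsub>quotient_space S N\<^esub>"
      using free_space.subspace_neg[OF S] by (auto simp: simps intro!: bexI[of _ "- p"])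
  qed (auto simp: simps algebra_simps free_space.subspace_0[OF S] free_space.subspace_add[OF S])
  ultimately show ?thesis
    by (rule module.intro, unfold module_axioms_def)
      (auto simp: simps field_ring_def free_space.scale_left_distrib
        free_space.scale_right_distrib free_space.subspace_scale[OF S])
qed

lemma minus_quotient_space:
  assumes N: "free_space.subspace N" and S: "free_space.subspace S" and "p \<in> S" "q \<in> S"
  shows "coset N p \<ominus>\<^bsub>quotient_space S N\<^esub> coset N q = coset N (p - q)"
proof -
  interpret abelian_group "quotient_space S N"
    using module_quotient_space[OF N S] by (rule module.axioms)
  have "\<ominus>\<^bsub>quotient_space S N\<^esub> coset N q = coset N (- q)"
    by (rule minus_equality) (use assms(4) free_space.subspace_neg[OF S] in
      \<open>auto simp: carrier_quotient_space add_quotient_space[OF N] zero_quotient_space\<close>)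
  then show ?thesis
    by (simp add: a_minus_def add_quotient_space[OF N])
qed

section \<open>Multilinearity in the letters\<close>

text \<open>Additivity and homogeneity in a letter are merged into one condition on \<open>x + c y\<close>, so that each induction
over words needs a single case distinction.\<close>

definition multilinear_mod ::
    "('k::field \<Rightarrow> 'v::ab_group_add \<Rightarrow> 'v) \<Rightarrow> ('y \<Rightarrow>\<^sub>0 'k) set \<Rightarrow> ('v list \<Rightarrow> ('y \<Rightarrow>\<^sub>0 'k)) \<Rightarrow> bool" where
  "multilinear_mod s N g \<longleftrightarrow>
     (\<forall>u x c y v. g (u @ (x + s c y) # v) - g (u @ x # v) - fscale c (g (u @ y # v)) \<in> N)"

abbreviation tclass ::
    "('k::field \<Rightarrow> 'v::ab_group_add \<Rightarrow> 'v) \<Rightarrow> ('v list \<Rightarrow>\<^sub>0 'k) \<Rightarrow> ('v list \<Rightarrow>\<^sub>0 'k) set" where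
  "tclass s \<equiv> coset (tensor_ideal s)"

lemma subspace_span [simp]: "free_space.subspace (free_space.span R)"
  by (rule free_space.subspace_span)

lemma linear_span_subset:
  assumes "free_linear F" "free_space.subspace N" "\<And>r. r \<in> R \<Longrightarrow> F r \<in> N"
    and "r \<in> free_space.span R"
  shows "F r \<in> N"
  using assms(4)
proof (induction rule: free_space.span_induct)
  show "free_space.subspace (Collect (\<lambda>r. F r \<in> N))"
    using assms(2) module_hom.zero[OF assms(1)] module_hom.add[OF assms(1)]
      module_hom.scale[OF assms(1)]
    by (simp add: free_space.subspace_def)
qed (rule assms(3))

lemma multilinear_gen: "multilinear_mod s (tensor_ideal s) gen"
  unfolding multilinear_mod_def
proof (intro allI)
  fix u x c y and v :: "'b list"
  have "(gen (u @ (x + s c y) # v) - gen (u @ x # v) - gen (u @ s c y # v))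
      + (gen (u @ s c y # v) - fscale c (gen (u @ y # v))) \<in> tensor_ideal s"
    by (intro free_space.span_add free_space.span_base)
      (unfold multilinear_rels_def, blast+)
  then show "gen (u @ (x + s c y) # v) - gen (u @ x # v) - fscale c (gen (u @ y # v))
      \<in> tensor_ideal s"
    by simp
qed

text \<open>Homogeneity is the case \<open>x = 0\<close> of the merged condition, given that \<open>g\<close> vanishes modulo \<open>N\<close> on words with
a zero letter; the latter follows from \<open>0 + 1 \<cdot> 0 = 0\<close>.\<close>

lemma lin_ext_tensor_ideal:
  assumes s: "vector_space s" and N: "free_space.subspace N" and g: "multilinear_mod s N g"
    and r: "r \<in> tensor_ideal s"
  shows "lin_ext g r \<in> N"
proof (rule linear_span_subset[OF free_linear_lin_ext N _ r])
  interpret vector_space s by (fact s)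
  have g: "g (u @ (x + s c y) # v) - g (u @ x # v) - fscale c (g (u @ y # v)) \<in> N" for u x c y v
    using g by (simp add: multilinear_mod_def)
  have zero: "g (u @ 0 # v) \<in> N" for u v
    using free_space.subspace_neg[OF N g[of u 0 1 0 v]] by simp
  fix r assume "r \<in> multilinear_rels s"
  then consider u x y v where "r = gen (u @ (x + y) # v) - gen (u @ x # v) - gen (u @ y # v)"
    | u c x v where "r = gen (u @ s c x # v) - fscale c (gen (u @ x # v))"
    by (auto simp: multilinear_rels_def)
  then show "lin_ext g r \<in> N"
  proof cases
    case 1
    then show ?thesis using g[of u x 1 y v] by simp
  next
    case 2
    then show ?thesis
      using free_space.subspace_add[OF N g[of u 0 c x v] zero[of u v]] by simp
  qed
qed

lemma on_cosets_tclass: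
  assumes "vector_space s" "free_space.subspace N" "multilinear_mod s N g"
  shows "on_cosets N (lin_ext g) (tclass s p) = coset N (lin_ext g p)"
  using assms by (intro on_cosets_coset free_linear_lin_ext lin_ext_tensor_ideal)
    (auto intro: free_space.span_zero)

text \<open>A bilinear operation on formal words that is multilinear in the letters of either argument descends to the
tensor algebra.\<close>

lemma on_cosets2_tclass:
  assumes s: "vector_space s" and N: "free_space.subspace N"
    and left: "\<And>v. multilinear_mod s N (\<lambda>u. g u v)" and right: "\<And>u. multilinear_mod s N (g u)"
  shows "on_cosets2 N (bilin_ext g) (tclass s p) (tclass s q) = coset N (bilin_ext g p q)"
proof (rule on_cosets2_coset[OF N])
  fix r q' assume r: "r \<in> tensor_ideal s"
  show "bilin_ext g r q' \<in> N"
    by (rule linear_in_subspace[OF _ N, of "bilin_ext g r"], intro free_linear_intros)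
      (simp add: bilin_ext_gen_right lin_ext_tensor_ideal[OF s N left r])
next
  fix r assume r: "r \<in> tensor_ideal s"
  show "bilin_ext g p r \<in> N"
    by (rule linear_in_subspace[OF _ N, of "\<lambda>p. bilin_ext g p r"], intro free_linear_intros)
      (simp add: lin_ext_tensor_ideal[OF s N right r])
qed (simp_all add: free_space.span_zero)

lemma prepend_letter_linear:
  "prepend (x + s c y) p - prepend x p - fscale c (prepend y p) \<in> tensor_ideal s"
proof (rule linear_in_subspace[where F =
      "\<lambda>p. prepend (x + s c y) p - prepend x p - fscale c (prepend y p)"])
  fix w
  show "prepend (x + s c y) (gen w) - prepend x (gen w) - fscale c (prepend y (gen w))
      \<in> tensor_ideal s"
    using multilinear_gen[of s, unfolded multilinear_mod_def, rule_format, of "[]" x c y w]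
    by (simp flip: gen_Cons)
qed (simp_all add: free_linear_iff algebra_simps)

lemma prepend_tensor_ideal:
  assumes "vector_space s" "r \<in> tensor_ideal s"
  shows "prepend x r \<in> tensor_ideal s"
  unfolding prepend_def
proof (rule lin_ext_tensor_ideal[OF assms(1) _ _ assms(2)])
  show "multilinear_mod s (tensor_ideal s) (\<lambda>w. gen (x # w))"
    using multilinear_gen[of s] unfolding multilinear_mod_def
    by (metis append_Cons)
qed simp

text \<open>The next two lemmas propagate multilinearity through the recursion equations, whose right-hand sides are sums
of terms \<open>prepend x p\<close>.\<close>

lemma linear_combination_sum:
  assumes "free_space.subspace N" "p - p' - fscale c p'' \<in> N" "q - q' - fscale c q'' \<in> N"
  shows "(p + q) - (p' + q') - fscale c (p'' + q'') \<in> N"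
  using free_space.subspace_add[OF assms]
  by (simp add: free_space.scale_right_distrib algebra_simps)

lemma prepend_linear_combination:
  assumes "vector_space s" "p - p' - fscale c p'' \<in> tensor_ideal s"
  shows "prepend x p - prepend x p' - fscale c (prepend x p'') \<in> tensor_ideal s"
  using prepend_tensor_ideal[OF assms, of x] by simp

text \<open>The nested induction follows the recursion of the shuffle: if the distinguished letter is the first one of the
left word and is consumed, linearity comes from \<open>prepend_letter_linear\<close>; if another letter is consumed,
one of the two words gets shorter.\<close>

lemma multilinear_shuffle_words:
  assumes s: "vector_space s"
  shows "multilinear_mod s (tensor_ideal s) (\<lambda>u. shuffle_words u w)"
  unfolding multilinear_mod_def
proof (intro allI)
  fix u x c y v
  show "shuffle_words (u @ (x + s c y) # v) w - shuffle_words (u @ x # v) w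
      - fscale c (shuffle_words (u @ y # v) w) \<in> tensor_ideal s"
  proof (induction u arbitrary: w)
    case Nil
    show ?case
    proof (induction w)
      case Nil
      then show ?case
        using multilinear_gen[of s, unfolded multilinear_mod_def] by simp (metis append_Nil)
    next
      case (Cons z w)
      then show ?case
        using s by (auto intro!: linear_combination_sum prepend_letter_linear
            prepend_linear_combination)
    qed
  next
    case (Cons a u)
    note outer = this
    show ?case
    proof (induction w)
      case Nil
      then show ?case
        using multilinear_gen[of s, unfolded multilinear_mod_def] by simp (metis append_Cons)
    next
      case (Cons z w)
      then show ?case
        using s outer by (auto intro!: linear_combination_sum prepend_linear_combination)
    qed
  qed
qed

lemma multilinear_shuffle_words_right:
  assumes "vector_space s"
  shows "multilinear_mod s (tensor_ideal s) (shuffle_words w)"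
  using multilinear_shuffle_words[OF assms, of w] by (simp add: shuffle_words_commute[of _ w])

lemma multilinear_bullet_words:
  assumes s: "vector_space s" and f: "Vector_Spaces.linear s s f"
  shows "multilinear_mod s (tensor_ideal s) (\<lambda>u. bullet_words f u w)"
  unfolding multilinear_mod_def
proof (intro allI)
  interpret f: Vector_Spaces.linear s s f by (fact f)
  fix u x c y v
  show "bullet_words f (u @ (x + s c y) # v) w - bullet_words f (u @ x # v) w
      - fscale c (bullet_words f (u @ y # v) w) \<in> tensor_ideal s"
  proof (induction u)
    case Nil
    show ?case
      using s by (auto simp: f.add f.scale intro!: linear_combination_sum prepend_letter_linear)
  next
    case (Cons a u)
    then show ?case
      using s multilinear_shuffle_words[OF s, unfolded multilinear_mod_def]
      by (auto intro!: linear_combination_sum prepend_linear_combination)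
  qed
qed

lemma multilinear_bullet_words_right:
  assumes s: "vector_space s"
  shows "multilinear_mod s (tensor_ideal s) (bullet_words f w)"
  unfolding multilinear_mod_def
proof (intro allI)
  fix u x c y v
  show "bullet_words f w (u @ (x + s c y) # v) - bullet_words f w (u @ x # v)
      - fscale c (bullet_words f w (u @ y # v)) \<in> tensor_ideal s"
  proof (induction w)
    case Nil
    show ?case by (simp add: free_space.span_zero)
  next
    case (Cons a w)
    then show ?case
      using s multilinear_shuffle_words_right[OF s, unfolded multilinear_mod_def]
      by (auto intro!: linear_combination_sum prepend_linear_combination)
  qed
qed

lemma multilinear_half_shuffle_words:
  assumes s: "vector_space s"
  shows "multilinear_mod s (tensor_ideal s) (\<lambda>u. half_shuffle_words u w)"
  unfolding multilinear_mod_def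
proof (intro allI)
  fix u x c y v
  show "half_shuffle_words (u @ (x + s c y) # v) w - half_shuffle_words (u @ x # v) w
      - fscale c (half_shuffle_words (u @ y # v) w) \<in> tensor_ideal s"
    using s multilinear_shuffle_words[OF s, unfolded multilinear_mod_def]
    by (cases u) (auto intro!: prepend_letter_linear prepend_linear_combination)
qed

text \<open>A relation involves nonempty words only, so the arbitrary value of \<open>\<emptyset> \<prec> \<emptyset>\<close> does not occur in it.\<close>

lemma multilinear_half_shuffle_words_right:
  assumes s: "vector_space s"
  shows "multilinear_mod s (tensor_ideal s) (half_shuffle_words w)"
  unfolding multilinear_mod_def
proof (intro allI)
  fix u x c y and v :: "'b list"
  have Nil: "half_shuffle_words [] (u @ z # v) = 0" for z
    by (cases u) auto
  show "half_shuffle_words w (u @ (x + s c y) # v) - half_shuffle_words w (u @ x # v)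
      - fscale c (half_shuffle_words w (u @ y # v)) \<in> tensor_ideal s"
    using s multilinear_shuffle_words_right[OF s, unfolded multilinear_mod_def]
    by (cases w) (auto simp: Nil free_space.span_zero intro!: prepend_linear_combination)
qed

section \<open>The operations on the tensor algebra\<close>

lemma carrier_tensor_algebra: "carrier (tensor_algebra s) = range (tclass s)"
  by (simp add: tensor_algebra_def carrier_quotient_space)

lemma add_tensor_algebra: "tclass s p \<oplus>\<^bsub>tensor_algebra s\<^esub> tclass s q = tclass s (p + q)"
  by (simp add: tensor_algebra_def add_quotient_space)

lemma smult_tensor_algebra: "c \<odot>\<^bsub>tensor_algebra s\<^esub> tclass s p = tclass s (fscale c p)"
  by (simp add: tensor_algebra_def smult_quotient_space)

lemma minus_tensor_algebra: "tclass s p \<ominus>\<^bsub>tensor_algebra s\<^esub> tclass s q = tclass s (p - q)"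
  by (simp add: tensor_algebra_def minus_quotient_space)

lemma shuffle_tclass:
  assumes "vector_space s"
  shows "shuffle s (tclass s p) (tclass s q) = tclass s (shuf p q)"
  unfolding shuffle_def using assms
  by (intro on_cosets2_tclass multilinear_shuffle_words multilinear_shuffle_words_right) auto

lemma half_shuffle_tclass:
  assumes "vector_space s"
  shows "half_shuffle s (tclass s p) (tclass s q) = tclass s (half_shuf p q)"
  unfolding half_shuffle_def using assms
  by (intro on_cosets2_tclass multilinear_half_shuffle_words
      multilinear_half_shuffle_words_right) auto

lemma bullet_tclass:
  assumes "vector_space s" "Vector_Spaces.linear s s f"
  shows "bullet s f (tclass s p) (tclass s q) = tclass s (bul f p q)"
  unfolding bullet_def using assms
  by (intro on_cosets2_tclass multilinear_bullet_words multilinear_bullet_words_right) auto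

lemma bilinear_product_tensor_algebra:
  assumes "\<And>p q. P (tclass s p) (tclass s q) = tclass s (bilin_ext g p q)"
  shows "bilinear_product (tensor_algebra s) P"
  unfolding bilinear_product_def carrier_tensor_algebra
  by (auto simp: assms add_tensor_algebra smult_tensor_algebra)

section \<open>Deconcatenation\<close>

text \<open>Linearity is relative to carriers, because an operation on classes is linear only on actual cosets and has no
meaning on other sets.\<close>

definition linear_between ::
    "('k::field, 'a) module \<Rightarrow> ('k, 'b) module \<Rightarrow> ('a \<Rightarrow> 'b) \<Rightarrow> bool" where
  "linear_between M N g \<longleftrightarrow>
     (\<forall>m\<in>carrier M. g m \<in> carrier N) \<and>
     (\<forall>m\<in>carrier M. \<forall>m'\<in>carrier M. g (m \<oplus>\<^bsub>M\<^esub> m') = g m \<oplus>\<^bsub>N\<^esub> g m') \<and>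
     (\<forall>c. \<forall>m\<in>carrier M. g (c \<odot>\<^bsub>M\<^esub> m) = c \<odot>\<^bsub>N\<^esub> g m)"

lemma linear_between_id: "linear_between M M id"
  by (simp add: linear_between_def)

lemma linear_between_bilinear_product:
  assumes "bilinear_product A P" "a \<in> carrier A"
  shows "linear_between A A (\<lambda>x. P x a)" "linear_between A A (P a)"
  using assms by (auto simp: bilinear_product_def linear_between_def)

lemma bilinear_relsI:
  "\<lbrakk>m \<in> carrier M; m' \<in> carrier M; n \<in> carrier N\<rbrakk>
    \<Longrightarrow> gen (m \<oplus>\<^bsub>M\<^esub> m', n) - gen (m, n) - gen (m', n) \<in> bilinear_rels M N"
  "\<lbrakk>m \<in> carrier M; n \<in> carrier N; n' \<in> carrier N\<rbrakk>
    \<Longrightarrow> gen (m, n \<oplus>\<^bsub>N\<^esub> n') - gen (m, n) - gen (m, n') \<in> bilinear_rels M N"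
  "\<lbrakk>m \<in> carrier M; n \<in> carrier N\<rbrakk>
    \<Longrightarrow> gen (c \<odot>\<^bsub>M\<^esub> m, n) - fscale c (gen (m, n)) \<in> bilinear_rels M N"
  "\<lbrakk>m \<in> carrier M; n \<in> carrier N\<rbrakk>
    \<Longrightarrow> gen (m, c \<odot>\<^bsub>N\<^esub> n) - fscale c (gen (m, n)) \<in> bilinear_rels M N"
  unfolding bilinear_rels_def by blast+

lemma tensor_map_bilinear_rels:
  assumes g: "linear_between M M' g" and h: "linear_between N N' h"
    and r: "r \<in> free_space.span (bilinear_rels M N)"
  shows "lin_ext (\<lambda>(m, n). gen (g m, h n)) r \<in> free_space.span (bilinear_rels M' N')"
proof (rule linear_span_subset[OF free_linear_lin_ext _ _ r])
  fix r assume "r \<in> bilinear_rels M N"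
  then have "lin_ext (\<lambda>(m, n). gen (g m, h n)) r \<in> bilinear_rels M' N'"
    using g h bilinear_relsI[where M = M' and N = N']
    unfolding bilinear_rels_def[of M N]
    by (elim UnE CollectE exE conjE) (simp_all add: linear_between_def)
  then show "lin_ext (\<lambda>(m, n). gen (g m, h n)) r \<in> free_space.span (bilinear_rels M' N')"
    by (rule free_space.span_base)
qed simp

lemma tensor_map_coset:
  assumes "linear_between M M' g" "linear_between N N' h"
  shows "tensor_map M' N' g h (coset (free_space.span (bilinear_rels M N)) t)
      = coset (free_space.span (bilinear_rels M' N')) (lin_ext (\<lambda>(m, n). gen (g m, h n)) t)"
  unfolding tensor_map_def using assms
  by (intro on_cosets_coset free_linear_lin_ext tensor_map_bilinear_rels)
    (auto intro: free_space.span_zero)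

lemma subspace_keys: "free_space.subspace {p. Poly_Mapping.keys p \<subseteq> A}"
  unfolding free_space.subspace_def
  by (auto simp: in_keys_iff subset_iff lookup_add) (metis add_0)

text \<open>Together with \<open>subspace_keys\<close> this shows that all representatives of an element of a tensor product are
supported on pairs from the carriers.\<close>

lemma keys_bilinear_rels:
  assumes "Module.module field_ring M" "Module.module field_ring N"
    and "r \<in> free_space.span (bilinear_rels M N)"
  shows "Poly_Mapping.keys r \<subseteq> carrier M \<times> carrier N"
proof -
  interpret M: Module.module field_ring M by (fact assms(1))
  interpret N: Module.module field_ring N by (fact assms(2))
  have "c \<odot>\<^bsub>M\<^esub> m \<in> carrier M" if "m \<in> carrier M" for c m
    using M.smult_closed that by (simp add: field_ring_def)
  moreover have "c \<odot>\<^bsub>N\<^esub> n \<in> carrier N" if "n \<in> carrier N" for c n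
    using N.smult_closed that by (simp add: field_ring_def)
  ultimately have "bilinear_rels M N \<subseteq> {p. Poly_Mapping.keys p \<subseteq> carrier M \<times> carrier N}"
    unfolding bilinear_rels_def
    by (auto simp: in_keys_iff lookup_minus lookup_single when_def split: if_splits)
  then show ?thesis
    using free_space.span_minimal[OF _ subspace_keys] assms(3) by blast
qed

text \<open>With one argument fixed to a pair \<open>m \<otimes> n\<close> from the carriers, the map is of the kind treated in
\<open>tensor_map_bilinear_rels\<close>. This is why the supports of both arguments must lie in the carriers.\<close>

lemma tensor_map2_coset:
  fixes A :: "('k::field, 'a) module"
  assumes A: "Module.module field_ring A"
    and P: "bilinear_product A P" and Q: "bilinear_product A Q"
    and keys: "Poly_Mapping.keys t \<subseteq> carrier A \<times> carrier A" "Poly_Mapping.keys t' \<subseteq> carrier A \<times> carrier A"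
  defines "J \<equiv> free_space.span (bilinear_rels A A)"
  shows "tensor_map2 A A P Q (coset J t) (coset J t')
      = coset J (bilin_ext (\<lambda>(m, n) (m', n'). gen (P m m', Q n n')) t t')"
  unfolding tensor_map2_def J_def[symmetric]
proof (rule on_cosets2_coset)
  let ?G = "bilin_ext (\<lambda>(m, n) (m', n'). gen (P m m', Q n n'))"
  show J: "free_space.subspace J"
    by (simp add: J_def)
  show "0 \<in> J" "0 \<in> J"
    using J by (rule free_space.subspace_0)+
  note linear = linear_between_bilinear_product[OF P] linear_between_bilinear_product[OF Q]
  fix r assume r: "r \<in> J"
  show "?G t r \<in> J"
  proof (rule linear_in_subspace[of "\<lambda>t. ?G t r"])
    fix x assume "x \<in> Poly_Mapping.keys t"
    with keys obtain m n where "x = (m, n)" "m \<in> carrier A" "n \<in> carrier A"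
      by auto
    then show "?G (gen x) r \<in> J"
      using tensor_map_bilinear_rels[of A A "P m" A A "Q n"] linear r by (simp add: J_def)
  qed (intro free_linear_intros J)+
  fix q assume q: "q \<in> coset J t'"
  have "Poly_Mapping.keys (t' + (q - t')) \<subseteq> carrier A \<times> carrier A"
    using q keys_bilinear_rels[OF A A, of "q - t'"] keys(2) free_space.subspace_add[OF subspace_keys]
    by (metis J_def mem_Collect_eq mem_coset)
  then have keys_q: "Poly_Mapping.keys q \<subseteq> carrier A \<times> carrier A"
    by simp
  show "?G r q \<in> J"
  proof (rule linear_in_subspace[of "?G r"])
    fix x assume "x \<in> Poly_Mapping.keys q"
    with keys_q obtain m n where "x = (m, n)" "m \<in> carrier A" "n \<in> carrier A"
      by auto
    then show "?G r (gen x) \<in> J"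
      using tensor_map_bilinear_rels[of A A "\<lambda>k. P k m" A A "\<lambda>k. Q k n" r] linear r
      by (simp add: J_def bilin_ext_gen_right case_prod_unfold)
  qed (intro free_linear_intros J)+
qed simp_all

abbreviation tensor_square_rels ::
    "('k::field \<Rightarrow> 'v::ab_group_add \<Rightarrow> 'v)
       \<Rightarrow> (('v list \<Rightarrow>\<^sub>0 'k) set \<times> ('v list \<Rightarrow>\<^sub>0 'k) set \<Rightarrow>\<^sub>0 'k) set" where
  "tensor_square_rels s \<equiv> free_space.span (bilinear_rels (tensor_algebra s) (tensor_algebra s))"

text \<open>The elements of the tensor square are represented by formal combinations of pairs of cosets. The map
\<open>word_pairs s\<close> sends a formal combination of pairs of words to such a representative.\<close>

abbreviation word_pairs ::
    "('k::field \<Rightarrow> 'v::ab_group_add \<Rightarrow> 'v) \<Rightarrow> ('v list \<times> 'v list \<Rightarrow>\<^sub>0 'k)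
       \<Rightarrow> (('v list \<Rightarrow>\<^sub>0 'k) set \<times> ('v list \<Rightarrow>\<^sub>0 'k) set \<Rightarrow>\<^sub>0 'k)" where
  "word_pairs s \<equiv> lin_ext (\<lambda>(u, v). gen (word s u, word s v))"

lemma tensor_left_linear:
  "gen (tclass s (p + fscale c q), tclass s r) - gen (tclass s p, tclass s r)
     - fscale c (gen (tclass s q, tclass s r)) \<in> tensor_square_rels s" (is ?left)
  and tensor_right_linear:
  "gen (tclass s r, tclass s (p + fscale c q)) - gen (tclass s r, tclass s p)
     - fscale c (gen (tclass s r, tclass s q)) \<in> tensor_square_rels s" (is ?right)
proof -
  let ?T = "tensor_algebra s"
  have "(gen (tclass s p \<oplus>\<^bsub>?T\<^esub> tclass s (fscale c q), tclass s r) - gen (tclass s p, tclass s r)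
        - gen (tclass s (fscale c q), tclass s r))
      + (gen (c \<odot>\<^bsub>?T\<^esub> tclass s q, tclass s r) - fscale c (gen (tclass s q, tclass s r)))
      \<in> tensor_square_rels s"
    by (intro free_space.span_add free_space.span_base)
      (auto simp: carrier_tensor_algebra intro!: bilinear_relsI)
  then show ?left
    by (simp add: add_tensor_algebra smult_tensor_algebra)
  have "(gen (tclass s r, tclass s p \<oplus>\<^bsub>?T\<^esub> tclass s (fscale c q)) - gen (tclass s r, tclass s p)
        - gen (tclass s r, tclass s (fscale c q)))
      + (gen (tclass s r, c \<odot>\<^bsub>?T\<^esub> tclass s q) - fscale c (gen (tclass s r, tclass s q)))
      \<in> tensor_square_rels s"
    by (intro free_space.span_add free_space.span_base)
      (auto simp: carrier_tensor_algebra intro!: bilinear_relsI)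
  then show ?right
    by (simp add: add_tensor_algebra smult_tensor_algebra)
qed

text \<open>This treats the maps sending an element \<open>p\<close> of the tensor algebra to the generators \<open>p \<otimes> q\<close> and \<open>q \<otimes> p\<close>
of the tensor square, which are linear only modulo the bilinearity relations.\<close>

lemma linear_mod_unique:
  assumes N: "free_space.subspace N" and F: "free_linear F"
    and G: "\<And>p c q. G (p + fscale c q) - G p - fscale c (G q) \<in> N"
    and gen: "\<And>x. G (gen x) - F (gen x) \<in> N"
  shows "G p - F p \<in> N"
proof -
  have zero: "G 0 \<in> N"
    using free_space.subspace_neg[OF N G[of 0 1 0]] by simp
  have "G (\<Sum>x\<in>A. fscale (c x) (gen x)) - F (\<Sum>x\<in>A. fscale (c x) (gen x)) \<in> N"
    if "finite A" for A c
    using that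
  proof (induction A)
    case empty
    then show ?case using zero by (simp add: module_hom.zero[OF F])
  next
    case (insert a A)
    let ?p = "\<Sum>x\<in>A. fscale (c x) (gen x)"
    have "(G (?p + fscale (c a) (gen a)) - G ?p - fscale (c a) (G (gen a)))
        + (G ?p - F ?p) + fscale (c a) (G (gen a) - F (gen a)) \<in> N"
      by (intro free_space.subspace_add[OF N] free_space.subspace_scale[OF N] G gen insert.IH)
    then show ?case
      using insert.hyps
      by (simp add: module_hom.add[OF F] module_hom.scale[OF F] free_space.scale_right_diff_distrib
          algebra_simps)
  qed
  from this[of "Poly_Mapping.keys p" "Poly_Mapping.lookup p"] show ?thesis
    by (simp flip: gen_decomposition)
qed

text \<open>The bridge between formal words and the tensor square: expanding both factors into words does not change the
class of \<open>p \<otimes> q\<close>, by linearity in one factor at a time.\<close>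

lemma tensor_expand:
  "gen (tclass s p, tclass s q) - word_pairs s (tens p q) \<in> tensor_square_rels s"
proof (rule linear_mod_unique[where G = "\<lambda>p. gen (tclass s p, tclass s q)"])
  fix u
  show "gen (tclass s (gen u), tclass s q) - word_pairs s (tens (gen u) q) \<in> tensor_square_rels s"
    by (rule linear_mod_unique[where G = "\<lambda>q. gen (tclass s (gen u), tclass s q)"])
      (intro free_linear_intros tensor_right_linear | simp add: word_def free_space.span_zero)+
qed (intro free_linear_intros tensor_left_linear | simp)+

lemma word_letter_linear:
  "word s (u @ (x + s c y) # v) = tclass s (gen (u @ x # v) + fscale c (gen (u @ y # v)))"
  unfolding word_def using multilinear_gen[of s]
  by (intro coset_eqI) (simp_all add: multilinear_mod_def diff_diff_eq)

text \<open>The distinguished letter lies in the right part of the cut at \<open>i\<close> when \<open>i \<le> length u\<close>, and in the left part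
otherwise; in each summand the other part is constant.\<close>

lemma multilinear_deconcatenation:
  "multilinear_mod s (tensor_square_rels s)
     (\<lambda>w. \<Sum>i\<le>length w. gen (word s (take i w), word s (drop i w)))"
  unfolding multilinear_mod_def
proof (intro allI)
  fix u x c y v
  let ?g = "\<lambda>z i. gen (word s (take i (u @ z # v)), word s (drop i (u @ z # v)))"
  have "?g (x + s c y) i - ?g x i - fscale c (?g y i) \<in> tensor_square_rels s" for i
  proof (cases "i \<le> length u")
    case True
    then show ?thesis
      using tensor_right_linear[of s "gen (take i u)"]
      by (simp add: word_letter_linear) (simp add: word_def)
  next
    case False
    then obtain j where "i - length u = Suc j"
      by (metis Suc_diff_le Suc_diff_Suc not_le)
    then show ?thesis
      using False tensor_left_linear[of s _ _ _ "gen (drop j v)"]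
      by (simp add: word_letter_linear) (simp add: word_def)
  qed
  then have "(\<Sum>i\<le>length (u @ x # v). ?g (x + s c y) i - ?g x i - fscale c (?g y i))
      \<in> tensor_square_rels s"
    by (intro free_space.span_sum)
  then show "(\<Sum>i\<le>length (u @ (x + s c y) # v). ?g (x + s c y) i)
      - (\<Sum>i\<le>length (u @ x # v). ?g x i) - fscale c (\<Sum>i\<le>length (u @ y # v). ?g y i)
      \<in> tensor_square_rels s"
    by (simp add: sum_subtractf free_space.scale_sum_right
        del: sum.atMost_Suc take_append drop_append)
qed

lemma deconcatenation_tclass:
  assumes "vector_space s"
  shows "deconcatenation s (tclass s p)
      = coset (tensor_square_rels s) (word_pairs s (lin_ext splits p))"
proof -
  have "lin_ext (\<lambda>w. \<Sum>i\<le>length w. gen (word s (take i w), word s (drop i w))) p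
      = word_pairs s (lin_ext splits p)"
    by (rule linear_eqI[of _ _ p], (intro free_linear_intros)+)
      (simp add: splits_def lin_ext_sum)
  then show ?thesis
    unfolding deconcatenation_def
    using on_cosets_tclass[OF assms _ multilinear_deconcatenation] by simp
qed

lemma keys_word_pairs:
  "Poly_Mapping.keys (word_pairs s t) \<subseteq> carrier (tensor_algebra s) \<times> carrier (tensor_algebra s)"
proof -
  let ?C = "carrier (tensor_algebra s)"
  have "word_pairs s t \<in> {p. Poly_Mapping.keys p \<subseteq> ?C \<times> ?C}"
    by (rule linear_in_subspace[OF free_linear_lin_ext subspace_keys])
      (auto simp: carrier_tensor_algebra word_def)
  then show ?thesis by simp
qed

text \<open>Both maps on the right-hand side send a pair of words to a pair of classes of combinations of words, which
\<open>tensor_expand\<close> turns back into pairs of words. The equation is then the image of \<open>splits_bul\<close>.\<close>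

lemma deconcatenation_bullet:
  fixes s :: "'k::field \<Rightarrow> 'v::ab_group_add \<Rightarrow> 'v"
  assumes s: "vector_space s" and f: "Vector_Spaces.linear s s f"
  shows "deconcatenation s (bullet s f (tclass s p) (tclass s q)) =
      tensor_map (tensor_algebra s) (tensor_algebra s) id (\<lambda>x. bullet s f x (tclass s q))
          (deconcatenation s (tclass s p))
        \<oplus>\<^bsub>tensor_square s\<^esub>
      tensor_map2 (tensor_algebra s) (tensor_algebra s) (bullet s f) (shuffle s)
          (deconcatenation s (tclass s p)) (deconcatenation s (tclass s q))"
proof -
  let ?J = "tensor_square_rels s"
  note bul = bullet_tclass[OF s f] and sh = shuffle_tclass[OF s]
  note bil = bilinear_product_tensor_algebra[of "bullet s f", OF bul]
    bilinear_product_tensor_algebra[of "shuffle s", OF sh]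
  let ?L = "lin_ext (\<lambda>(m, n). gen (id m, bullet s f n (tclass s q)))"
  have "?L (word_pairs s t) - word_pairs s (id_bul f t q) \<in> ?J" for t
  proof (rule linear_in_subspace[where F = "\<lambda>t. ?L (word_pairs s t) - word_pairs s (id_bul f t q)"])
    fix x :: "'v list \<times> 'v list"
    obtain u v where x: "x = (u, v)" by fastforce
    have "id_bul f (gen (u, v)) q = tens (gen u) (bul f (gen v) q)"
      by (rule linear_eqI[of _ _ q], (intro free_linear_intros)+) simp
    then show "?L (word_pairs s (gen x)) - word_pairs s (id_bul f (gen x) q) \<in> ?J"
      using tensor_expand[of s "gen u" "bul f (gen v) q"]
      by (simp del: bilin_ext_gen_left add: x word_def bul)
  qed (intro free_linear_intros | simp)+
  then have 1: "tensor_map (tensor_algebra s) (tensor_algebra s) id (\<lambda>x. bullet s f x (tclass s q))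
      (coset ?J (word_pairs s t)) = coset ?J (word_pairs s (id_bul f t q))" for t
    using linear_between_bilinear_product(1)[OF bil(1), of "tclass s q"]
    by (subst tensor_map_coset)
      (auto simp: linear_between_id carrier_tensor_algebra intro!: coset_eqI)
  let ?G = "bilin_ext (\<lambda>(m, n) (m', n'). gen (bullet s f m m', shuffle s n n'))"
  have "?G (word_pairs s t) (word_pairs s t') - word_pairs s (bul_shuf2 f t t') \<in> ?J" for t t'
  proof (rule linear_in_subspace[where F =
        "\<lambda>t. ?G (word_pairs s t) (word_pairs s t') - word_pairs s (bul_shuf2 f t t')"])
    fix x
    show "?G (word_pairs s (gen x)) (word_pairs s t') - word_pairs s (bul_shuf2 f (gen x) t') \<in> ?J"
    proof (rule linear_in_subspace[where F =
        "\<lambda>t'. ?G (word_pairs s (gen x)) (word_pairs s t') - word_pairs s (bul_shuf2 f (gen x) t')"])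
      fix y
      show "?G (word_pairs s (gen x)) (word_pairs s (gen y))
          - word_pairs s (bul_shuf2 f (gen x) (gen y)) \<in> ?J"
        using tensor_expand[of s "bullet_words f (fst x) (fst y)" "shuffle_words (snd x) (snd y)"]
        by (simp add: case_prod_beta word_def bul sh)
    qed (intro free_linear_intros | simp)+
  qed (intro free_linear_intros | simp)+
  then have 2: "tensor_map2 (tensor_algebra s) (tensor_algebra s) (bullet s f) (shuffle s)
      (coset ?J (word_pairs s t)) (coset ?J (word_pairs s t'))
      = coset ?J (word_pairs s (bul_shuf2 f t t'))" for t t'
    by (subst tensor_map2_coset[OF _ bil keys_word_pairs keys_word_pairs])
      (auto simp: tensor_algebra_def module_quotient_space intro!: coset_eqI)
  show ?thesis
    by (simp add: bul deconcatenation_tclass[OF s] 1 2 splits_bul tensor_product_def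
        add_quotient_space)
qed

theorem theorem2:
  fixes s :: "'k::field_char_0 \<Rightarrow> 'v::ab_group_add \<Rightarrow> 'v"
    and f :: "'v \<Rightarrow> 'v"
  assumes "vector_space s"
    and "Vector_Spaces.linear s s f"
  shows
    "(\<forall>a\<in>carrier (tensor_algebra s). \<forall>b\<in>carrier (tensor_algebra s). \<forall>c\<in>carrier (tensor_algebra s).
        bullet s f (shuffle s a b) c =
          shuffle s (bullet s f a c) b \<oplus>\<^bsub>tensor_algebra s\<^esub> shuffle s a (bullet s f b c)) \<and>
     (\<forall>u v w :: 'v list. (u, v) \<noteq> ([], []) \<longrightarrow>
        bullet s f (half_shuffle s (word s u) (word s v)) (word s w) =
          half_shuffle s (bullet s f (word s u) (word s w)) (word s v)
            \<oplus>\<^bsub>tensor_algebra s\<^esub> half_shuffle s (word s u) (bullet s f (word s v) (word s w))) \<and>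
     (\<forall>a\<in>carrier (tensor_algebra s). \<forall>b\<in>carrier (tensor_algebra s). \<forall>c\<in>carrier (tensor_algebra s).
        bullet s f (bullet s f a b) c \<ominus>\<^bsub>tensor_algebra s\<^esub> bullet s f a (bullet s f b c) =
          bullet s f (bullet s f a c) b \<ominus>\<^bsub>tensor_algebra s\<^esub> bullet s f a (bullet s f c b)) \<and>
     (\<forall>a\<in>carrier (tensor_algebra s). \<forall>b\<in>carrier (tensor_algebra s).
        deconcatenation s (bullet s f a b) =
          tensor_map (tensor_algebra s) (tensor_algebra s) id (\<lambda>x. bullet s f x b)
              (deconcatenation s a)
            \<oplus>\<^bsub>tensor_square s\<^esub>
          tensor_map2 (tensor_algebra s) (tensor_algebra s) (bullet s f) (shuffle s)
              (deconcatenation s a) (deconcatenation s b)) \<and>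
     com_pre_lie_algebra (tensor_algebra s) (shuffle s) (bullet s f)"
proof -
  note bul = bullet_tclass[OF assms] and sh = shuffle_tclass[OF assms(1)]
    and half = half_shuffle_tclass[OF assms(1)]
  note arith = add_tensor_algebra minus_tensor_algebra
  have derivation: "\<forall>a\<in>carrier (tensor_algebra s). \<forall>b\<in>carrier (tensor_algebra s).
      \<forall>c\<in>carrier (tensor_algebra s). bullet s f (shuffle s a b) c =
        shuffle s (bullet s f a c) b \<oplus>\<^bsub>tensor_algebra s\<^esub> shuffle s a (bullet s f b c)"
    by (auto simp: carrier_tensor_algebra bul sh arith bul_shuf)
  have half_derivation: "bullet s f (half_shuffle s (word s u) (word s v)) (word s w) =
      half_shuffle s (bullet s f (word s u) (word s w)) (word s v)
        \<oplus>\<^bsub>tensor_algebra s\<^esub> half_shuffle s (word s u) (bullet s f (word s v) (word s w))"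
    if "(u, v) \<noteq> ([], [])" for u v w
    by (simp del: bilin_ext_gen_left add: word_def bul half arith bul_half_shuf[OF that])
  have pre_lie: "\<forall>a\<in>carrier (tensor_algebra s). \<forall>b\<in>carrier (tensor_algebra s).
      \<forall>c\<in>carrier (tensor_algebra s).
        bullet s f (bullet s f a b) c \<ominus>\<^bsub>tensor_algebra s\<^esub> bullet s f a (bullet s f b c) =
        bullet s f (bullet s f a c) b \<ominus>\<^bsub>tensor_algebra s\<^esub> bullet s f a (bullet s f c b)"
    by (auto simp: carrier_tensor_algebra bul arith
        intro!: arg_cong[where f = "tclass s"] bul_pre_lie)
  have deconcatenation: "\<forall>a\<in>carrier (tensor_algebra s). \<forall>b\<in>carrier (tensor_algebra s).
      deconcatenation s (bullet s f a b) =
        tensor_map (tensor_algebra s) (tensor_algebra s) id (\<lambda>x. bullet s f x b)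
            (deconcatenation s a)
          \<oplus>\<^bsub>tensor_square s\<^esub>
        tensor_map2 (tensor_algebra s) (tensor_algebra s) (bullet s f) (shuffle s)
            (deconcatenation s a) (deconcatenation s b)"
    using deconcatenation_bullet[OF assms] by (force simp: carrier_tensor_algebra)
  have module: "Module.module field_ring (tensor_algebra s)"
    by (simp add: tensor_algebra_def module_quotient_space)
  have "com_pre_lie_algebra (tensor_algebra s) (shuffle s) (bullet s f)"
    unfolding com_pre_lie_algebra_def
    using module derivation pre_lie bilinear_product_tensor_algebra[of "shuffle s", OF sh]
      bilinear_product_tensor_algebra[of "bullet s f", OF bul]
    by (auto simp: carrier_tensor_algebra sh shuf_assoc
        intro!: arg_cong[where f = "tclass s"] shuf_commute)
  with derivation half_derivation pre_lie deconcatenation show ?thesis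
    by blast
qed

end
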